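(* Let $p>1$ and let $F$ be a differentiable higher order strongly general convex function on the general convex set $K_g$ with modulus $\mu>0$. If $u\in H$ with $g(u)\in K_g$ is the minimum of the function $F$, that is, $F(g(u))\le F(g(v))$ for all $v\in H$ with $g(v)\in K_g$, then $$F(g(v))-F(g(u))\ge\mu\,\|g(v)-g(u)\|^p\qquad\text{for all } v\in H \text{ with } g(v)\in K_g .$$
   Context: $H$ is a real Hilbert space with inner product $\langle\cdot,\cdot\rangle$ and norm $\|\cdot\|$, and $g:H\to H$ is an arbitrary function. $K_g\subseteq H$ is a general convex set with respect to $g$: $g(u)+t(g(v)-g(u))\in K_g$ for all $u,v\in H$ with $g(u),g(v)\in K_g$ and all $t\in[0,1]$. As a standing assumption $g$ is onto $K_g$ (every point of $K_g$ is $g(v)$ for some $v\in H$). For $p>1$ and $\mu>0$, a real-valued function $F$ on $K_g$ is higher order strongly general convex with modulus (constant) $\mu$ if $$F\big(g(u)+t(g(v)-g(u))\big)\le(1-t)F(g(u))+tF(g(v))-\mu\{t^p(1-t)+t(1-t)^p\}\|g(v)-g(u)\|^p$$ for all $u,v\in H$ with $g(u),g(v)\in K_g$ and all $t\in[0,1]$. "Differentiable" means Fréchet differentiable at the points of $K_g$ ($F$ being understood as defined near $K_g$). *)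

theory Defs
  imports "HOL-Analysis.Analysis"
begin

definition general_convex_set :: "('a::real_vector \<Rightarrow> 'a) \<Rightarrow> 'a set \<Rightarrow> bool" where
  "general_convex_set g K \<longleftrightarrow>
     (\<forall>u v. \<forall>t\<in>{0..1::real}. g u \<in> K \<longrightarrow> g v \<in> K \<longrightarrow> g u + t *\<^sub>R (g v - g u) \<in> K)"

text \<open>The exponent \<open>p\<close> is real and meant to be positive: then \<open>0 powr p = 0\<close> is the
  usual value at \<open>t = 0\<close>, at \<open>t = 1\<close> and for \<open>g u = g v\<close>.\<close>

definition higher_order_strongly_general_convex ::
  "real \<Rightarrow> real \<Rightarrow> ('a::real_normed_vector \<Rightarrow> 'a) \<Rightarrow> 'a set \<Rightarrow> ('a \<Rightarrow> real) \<Rightarrow> bool" where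
  "higher_order_strongly_general_convex p \<mu> g K F \<longleftrightarrow>
     (\<forall>u v. \<forall>t\<in>{0..1::real}. g u \<in> K \<longrightarrow> g v \<in> K \<longrightarrow>
        F (g u + t *\<^sub>R (g v - g u))
          \<le> (1 - t) * F (g u) + t * F (g v)
             - \<mu> * (t powr p * (1 - t) + t * (1 - t) powr p) * norm (g v - g u) powr p)"

end

theory Submission
  imports Defs
begin

text \<open>The segment from \<open>g u\<close> to \<open>g v\<close> stays in \<open>K\<close>, and every point of \<open>K\<close> is a value of \<open>g\<close>,
  so the minimality of \<open>F (g u)\<close> applies along the whole segment. Inserting it into the
  convexity inequality cancels \<open>F (g u)\<close> and leaves a multiple of \<open>t\<close> on the right; dividing by
  \<open>t\<close> bounds \<open>F (g v) - F (g u)\<close> below by \<open>\<mu> (1 - t)\<^sup>p \<parallel>g v - g u\<parallel>\<^sup>p\<close>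
  plus a nonnegative term. Letting \<open>t\<close> tend to \<open>0\<close> from the right gives the claim.\<close>

theorem theorem20:
  fixes g :: "'a::{real_inner, complete_space} \<Rightarrow> 'a"
    and K :: "'a set"
    and F :: "'a \<Rightarrow> real"
    and p \<mu> :: real
    and u :: 'a
  assumes "p > 1"
    and "\<mu> > 0"
    and "general_convex_set g K"
    and "K \<subseteq> range g"
    and "\<forall>x\<in>K. F differentiable (at x)"
    and "higher_order_strongly_general_convex p \<mu> g K F"
    and "g u \<in> K"
    and "\<forall>v. g v \<in> K \<longrightarrow> F (g u) \<le> F (g v)"
  shows "\<forall>v. g v \<in> K \<longrightarrow> F (g v) - F (g u) \<ge> \<mu> * norm (g v - g u) powr p"
proof (intro allI impI)
  fix v
  assume v: "g v \<in> K"
  define N where "N = norm (g v - g u) powr p"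
  have bound: "\<mu> * (1 - t) powr p * N \<le> F (g v) - F (g u)" if t: "0 < t" "t < 1" for t
  proof -
    have "g u + t *\<^sub>R (g v - g u) \<in> K"
      using assms(3,7) v t unfolding general_convex_set_def by simp
    then have "F (g u) \<le> F (g u + t *\<^sub>R (g v - g u))"
      using assms(4,8) by (metis rangeE subsetD)
    also have "\<dots> \<le> (1 - t) * F (g u) + t * F (g v)
        - \<mu> * (t powr p * (1 - t) + t * (1 - t) powr p) * N"
      using assms(6,7) v t unfolding higher_order_strongly_general_convex_def N_def by simp
    finally have "\<mu> * (t powr p * (1 - t)) * N + t * (\<mu> * (1 - t) powr p * N)
        \<le> t * (F (g v) - F (g u))"
      by (simp add: algebra_simps)
    moreover have "0 \<le> \<mu> * (t powr p * (1 - t)) * N"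
      using assms(2) t unfolding N_def by simp
    ultimately have "t * (\<mu> * (1 - t) powr p * N) \<le> t * (F (g v) - F (g u))"
      by linarith
    then show ?thesis
      using t by (simp only: mult_le_cancel_left_pos)
  qed
  have "((\<lambda>t. \<mu> * (1 - t) powr p * N) \<longlongrightarrow> \<mu> * (1 - 0) powr p * N) (at_right 0)"
    by (intro tendsto_intros) auto
  moreover have "\<forall>\<^sub>F t in at_right 0. \<mu> * (1 - t) powr p * N \<le> F (g v) - F (g u)"
    unfolding eventually_at_right_field using bound zero_less_one by blast
  ultimately have "\<mu> * (1 - 0) powr p * N \<le> F (g v) - F (g u)"
    by (rule tendsto_upperbound) simp
  then show "\<mu> * norm (g v - g u) powr p \<le> F (g v) - F (g u)"
    by (simp add: N_def)
qed

end
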